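(* Let $I\subset\mathbb{R}$ be an open bounded interval, and let $p\colon I\to\mathbb{R}$ be measurable such that for some constants $p^\pm$ one has $1<p^-<p(x)<p^+<\infty$ almost everywhere. Suppose $\gamma_1,\gamma_2\in L^\infty_+(I)$. If $p\colon I\to\mathbb{R}$ is a measurable injection and $\widetilde P(\gamma_1)=\widetilde P(\gamma_2)$, then $\gamma_1=\gamma_2$ (as elements of $L^\infty(I)$).
   Context: $L^\infty_+(I)=\{f\in L^\infty(I): \operatorname{ess\,inf} f>0\}$. $\sigma(p)$ is the sigma-algebra on $I$ generated by the sets $p^{-1}(A)$, $A\subseteq\mathbb{R}$ Borel. $L^2(I,\sigma(p))$ denotes the space of classes of square-integrable $\sigma(p)$-measurable functions (with respect to Lebesgue measure restricted to $\sigma(p)$), identified with the closed subspace of $L^2(I)$ of classes having a $\sigma(p)$-measurable representative. $P\colon L^2(I)\to L^2(I,\sigma(p))$ is the orthogonal projection. For $\gamma\in L^\infty_+(I)$, $\widetilde P(\gamma)(x)=\left(P\left(\gamma^{-1/(p-1)}\right)(x)\right)^{-(p(x)-1)}$. *)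

theory Defs
  imports "HOL-Probability.Essential_Supremum" "HOL-Probability.Conditional_Expectation"
begin

text \<open>
  Elements of \<open>L\<^sup>2\<close> and \<open>L\<^sup>\<infinity>\<close> are handled through representatives; equality of classes
  is equality almost everywhere.
\<close>

definition essinf :: "'a measure \<Rightarrow> ('a \<Rightarrow> real) \<Rightarrow> ereal" where
  "essinf M f = - esssup M (\<lambda>x. - ereal (f x))"

definition Linfty :: "'a measure \<Rightarrow> ('a \<Rightarrow> real) set" where
  "Linfty M = {f \<in> borel_measurable M. esssup M (\<lambda>x. ereal \<bar>f x\<bar>) < \<infinity>}"

definition Linfty_plus :: "'a measure \<Rightarrow> ('a \<Rightarrow> real) set" where
  "Linfty_plus M = {f \<in> Linfty M. essinf M f > 0}"

definition L2 :: "'a measure \<Rightarrow> ('a \<Rightarrow> real) set" where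
  "L2 M = {f \<in> borel_measurable M. integrable M (\<lambda>x. (f x)\<^sup>2)}"

definition L2_inner :: "'a measure \<Rightarrow> ('a \<Rightarrow> real) \<Rightarrow> ('a \<Rightarrow> real) \<Rightarrow> real" where
  "L2_inner M f g = (\<integral>x. f x * g x \<partial>M)"

definition sigma_gen :: "real set \<Rightarrow> (real \<Rightarrow> real) \<Rightarrow> real measure" where
  "sigma_gen I p = vimage_algebra I p borel"

text \<open>
  Here \<open>M\<close> restricted to the sub-sigma-algebra \<open>F\<close> need not be complete, so members of this
  subspace need not be \<open>F\<close>-measurable themselves; they only agree almost everywhere with
  such a function.
\<close>

definition L2_sub :: "'a measure \<Rightarrow> 'a measure \<Rightarrow> ('a \<Rightarrow> real) set" where
  "L2_sub M F = {f \<in> L2 M. \<exists>g \<in> L2 (restr_to_subalg M F). AE x in M. f x = g x}"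

text \<open>
  For a closed subspace \<open>S\<close> of \<open>L\<^sup>2\<close> and \<open>f\<close> in \<open>L\<^sup>2\<close>, the function selected below exists and
  is unique up to null sets.
\<close>

definition orth_proj :: "'a measure \<Rightarrow> ('a \<Rightarrow> real) set \<Rightarrow> ('a \<Rightarrow> real) \<Rightarrow> ('a \<Rightarrow> real)" where
  "orth_proj M S f =
     (SOME g. g \<in> S \<and> (\<forall>h\<in>S. L2_inner M (\<lambda>x. f x - g x) h = 0))"

definition P_op :: "real set \<Rightarrow> (real \<Rightarrow> real) \<Rightarrow> (real \<Rightarrow> real) \<Rightarrow> (real \<Rightarrow> real)" where
  "P_op I p = orth_proj (lebesgue_on I) (L2_sub (lebesgue_on I) (sigma_gen I p))"

definition P_tilde :: "real set \<Rightarrow> (real \<Rightarrow> real) \<Rightarrow> (real \<Rightarrow> real) \<Rightarrow> (real \<Rightarrow> real)" where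
  "P_tilde I p \<gamma> =
     (\<lambda>x. P_op I p (\<lambda>y. \<gamma> y powr (- 1 / (p y - 1))) x powr (- (p x - 1)))"

end

theory Submission
  imports Defs
begin

text \<open>
  If \<open>p\<close> is injective, then \<open>\<sigma>(p)\<close> exhausts the Lebesgue sets up to null sets, so \<open>P\<close> is the
  identity and the power \<open>-(p - 1)\<close> undoes the power \<open>-1/(p - 1)\<close>. To see the first claim without
  descriptive set theory, apply Lusin's theorem to the pair \<open>(p, f)\<close>: on the compact pieces \<open>K\<close>
  so obtained both functions are continuous, and for closed \<open>C\<close> the set \<open>L = {x \<in> K. f x \<in> C}\<close>
  is compact, hence so is \<open>p ` L\<close>, and \<open>L\<close> is the preimage of \<open>p ` L\<close> by injectivity.
\<close>

section \<open>Lusin's theorem for maps into second-countable spaces\<close>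

text \<open>Each preimage \<open>A n\<close> of a basic open set and its complement in
  \<open>S\<close> are approximated from inside by closed sets \<open>C n\<close> and
  \<open>D n\<close>. On \<open>K\<close>, the intersection of all \<open>C n \<union> D n\<close>,
  each \<open>A n\<close> is cut out by the open set \<open>- D n\<close>, which gives
  continuity.\<close>

lemma lusin_closed:
  fixes f :: "'a::euclidean_space \<Rightarrow> 'b::second_countable_topology"
  assumes S: "S \<in> sets lebesgue" and f: "f \<in> borel_measurable (lebesgue_on S)" and "e > 0"
  obtains K where "closed K" "K \<subseteq> S" "continuous_on K f" "emeasure lebesgue (S - K) < ennreal e"
proof -
  obtain B :: "'b set set" where B: "countable B" "topological_basis B"
    using ex_countable_basis by blast
  \<comment> \<open>The empty set keeps the enumerated family nonempty, so that its range is the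
    whole family; it is open and therefore harmless.\<close>
  define U where "U = from_nat_into (insert {} B)"
  have range_U: "range U = insert {} B"
    unfolding U_def using B(1) by (intro range_from_nat_into) auto
  have openU: "open (U n)" for n
    using range_U B(2) topological_basis_open by (metis insert_iff open_empty rangeI)
  define A where "A = (\<lambda>n. f -` U n \<inter> S)"
  have A: "A n \<in> sets lebesgue" for n
  proof -
    have "f -` U n \<inter> space (lebesgue_on S) \<in> sets (lebesgue_on S)"
      using f openU by (intro measurable_sets[of _ _ borel]) auto
    then show ?thesis
      using S by (auto simp: A_def sets_restrict_space_iff)
  qed
  have SA: "S - A n \<in> sets lebesgue" for n
    using A S by blast
  \<comment> \<open>The \<open>d n\<close> sum to \<open>e / 4\<close>. Two errors occur for each
    \<open>n\<close>, so the total loss is at most \<open>e / 2\<close>, strictly below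
    \<open>e\<close>.\<close>
  define d where "d = (\<lambda>n::nat. e / 4 * (1 / 2) ^ Suc n)"
  have d: "d n > 0" for n
    using \<open>e > 0\<close> by (simp add: d_def)
  have "\<exists>C. closed C \<and> C \<subseteq> A n \<and> emeasure lebesgue (A n - C) < ennreal (d n)" for n
    by (rule sets_lebesgue_inner_closed[OF A d]) blast
  then obtain C where C: "\<And>n. closed (C n)" "\<And>n. C n \<subseteq> A n"
      "\<And>n. emeasure lebesgue (A n - C n) < ennreal (d n)"
    by metis
  have "\<exists>D. closed D \<and> D \<subseteq> S - A n
      \<and> emeasure lebesgue ((S - A n) - D) < ennreal (d n)" for n
    by (rule sets_lebesgue_inner_closed[OF SA d]) blast
  then obtain D where D: "\<And>n. closed (D n)" "\<And>n. D n \<subseteq> S - A n"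
      "\<And>n. emeasure lebesgue ((S - A n) - D n) < ennreal (d n)"
    by metis
  define K where "K = (\<Inter>n. C n \<union> D n)"
  define E where "E = (\<lambda>n. (A n - C n) \<union> ((S - A n) - D n))"
  show thesis
  proof
    show "closed K"
      using C(1) D(1) by (auto simp: K_def)
    show "K \<subseteq> S"
      using C(2) D(2) by (fastforce simp: K_def A_def)
    show "continuous_on K f"
      unfolding continuous_on_topological
    proof (intro ballI allI impI)
      fix x V assume x: "x \<in> K" and V: "open V" "f x \<in> V"
      obtain W where W: "W \<in> B" "f x \<in> W" "W \<subseteq> V"
        using topological_basisE[OF B(2) V] by blast
      then obtain n where n: "W = U n"
        using range_U by (metis image_iff insertI2)
      have "x \<in> - D n"
        using W(2) n D(2) by (auto simp: A_def)
      moreover have "f y \<in> V" if "y \<in> K" "y \<in> - D n" for y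
        using that C(2)[of n] W(3) n by (auto simp: A_def K_def)
      ultimately show "\<exists>T. open T \<and> x \<in> T \<and> (\<forall>y\<in>K. y \<in> T \<longrightarrow> f y \<in> V)"
        using D(1)[of n] by (meson open_Compl)
    qed
    have CD: "A n - C n \<in> sets lebesgue" "(S - A n) - D n \<in> sets lebesgue" for n
      using A SA C(1) D(1) by (auto intro: sets.Diff)
    then have Esets: "range E \<subseteq> sets lebesgue"
      by (auto simp: E_def intro: sets.Un)
    have E: "emeasure lebesgue (E n) \<le> ennreal (2 * d n)" for n
    proof -
      have "emeasure lebesgue (E n) \<le> emeasure lebesgue (A n - C n) + emeasure lebesgue ((S - A n) - D n)"
        unfolding E_def using CD by (intro emeasure_subadditive) auto
      also have "\<dots> \<le> ennreal (d n) + ennreal (d n)"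
        using C(3) D(3) by (intro add_mono) (auto intro: less_imp_le)
      also have "\<dots> = ennreal (2 * d n)"
        using d[of n] by (simp flip: ennreal_plus)
      finally show ?thesis .
    qed
    have "(\<lambda>n. e / 2 * (1 / 2) ^ Suc n) sums (e / 2 * 1)"
      by (intro sums_mult power_half_series)
    then have sums: "(\<lambda>n. 2 * d n) sums (e / 2)"
      by (simp add: d_def)
    have "emeasure lebesgue (S - K) \<le> emeasure lebesgue (\<Union>n. E n)"
      using Esets by (intro emeasure_mono) (auto simp: K_def E_def)
    also have "\<dots> \<le> (\<Sum>n. emeasure lebesgue (E n))"
      by (intro emeasure_subadditive_countably Esets)
    also have "\<dots> \<le> (\<Sum>n. ennreal (2 * d n))"
      using E by (intro suminf_le) auto
    also have "\<dots> = ennreal (e / 2)"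
      using sums d by (intro suminf_ennreal_eq) (auto intro: less_imp_le)
    also have "\<dots> < ennreal e"
      using \<open>e > 0\<close> by (simp add: ennreal_lessI)
    finally show "emeasure lebesgue (S - K) < ennreal e" .
  qed
qed

text \<open>The remainder lies in every \<open>S - K n\<close>, whose measure is below
  \<open>1 / Suc n\<close>, so it is null.\<close>

lemma lusin_exhaustion:
  fixes f :: "'a::euclidean_space \<Rightarrow> 'b::second_countable_topology"
  assumes S: "S \<in> sets lebesgue" and f: "f \<in> borel_measurable (lebesgue_on S)"
  obtains K :: "nat \<Rightarrow> 'a set"
  where "\<And>n. closed (K n)" "\<And>n. K n \<subseteq> S" "\<And>n. continuous_on (K n) f"
    "S - (\<Union>n. K n) \<in> null_sets lebesgue"
proof -
  have "\<exists>K. closed K \<and> K \<subseteq> S \<and> continuous_on K f \<and> emeasure lebesgue (S - K) < ennreal (1 / Suc n)" for n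
    by (rule lusin_closed[OF S f, of "1 / Suc n"]) auto
  then obtain K where K: "\<And>n. closed (K n)" "\<And>n. K n \<subseteq> S" "\<And>n. continuous_on (K n) f"
      "\<And>n. emeasure lebesgue (S - K n) < ennreal (1 / Suc n)"
    by metis
  have sets: "S - (\<Union>n. K n) \<in> sets lebesgue" "\<And>n. S - K n \<in> sets lebesgue"
    using S K(1) by (auto intro!: sets.Diff sets.countable_UN)
  have "emeasure lebesgue (S - (\<Union>n. K n)) \<le> ennreal (1 / Suc n)" for n
  proof -
    have "emeasure lebesgue (S - (\<Union>n. K n)) \<le> emeasure lebesgue (S - K n)"
      using sets by (intro emeasure_mono) auto
    then show ?thesis
      using K(4)[of n] by simp
  qed
  moreover have "(\<lambda>n. ennreal (1 / Suc n)) \<longlonglongrightarrow> ennreal 0"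
    by (intro tendsto_ennrealI LIMSEQ_Suc[OF lim_1_over_n])
  ultimately have "emeasure lebesgue (S - (\<Union>n. K n)) \<le> ennreal 0"
    by (intro LIMSEQ_le_const) auto
  then show thesis
    using sets K(1-3) by (intro that[of K]) (auto simp: null_sets_def)
qed

section \<open>Measurability with respect to the sigma-algebra of an injection\<close>

lemma borel_measurable_AE_vimage_algebra_inj:
  fixes p :: "'a::euclidean_space \<Rightarrow> 'b::{second_countable_topology, t2_space}"
    and f :: "'a \<Rightarrow> real"
  assumes S: "S \<in> sets lebesgue" "bounded S"
    and p: "p \<in> borel_measurable (lebesgue_on S)" "inj_on p S"
    and f: "f \<in> borel_measurable (lebesgue_on S)"
  obtains g where "g \<in> borel_measurable (vimage_algebra S p borel)" "AE x in lebesgue_on S. f x = g x"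
proof -
  let ?F = "vimage_algebra S p borel"
  have "(\<lambda>x. (p x, f x)) \<in> borel_measurable (lebesgue_on S)"
    using p(1) f by (rule borel_measurable_Pair)
  from lusin_exhaustion[OF S(1) this] obtain K :: "nat \<Rightarrow> 'a set"
    where K: "\<And>n. closed (K n)" "\<And>n. K n \<subseteq> S" "\<And>n. continuous_on (K n) (\<lambda>x. (p x, f x))"
      and null: "S - (\<Union>n. K n) \<in> null_sets lebesgue"
    by blast
  have cont_p: "continuous_on (K n) p" and cont_f: "continuous_on (K n) f" for n
    using continuous_on_fst[OF K(3)[of n]] continuous_on_snd[OF K(3)[of n]] by simp_all
  have compactK: "compact (K n)" for n
    using K(1,2) S(2) bounded_subset compact_eq_bounded_closed by blast
  have piece: "{x \<in> K n. f x \<in> C} \<in> sets ?F" if "closed C" for C n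
  proof -
    let ?L = "{x \<in> K n. f x \<in> C}"
    have "closedin (top_of_set (K n)) (K n \<inter> f -` C)"
      using cont_f that by (rule continuous_closedin_preimage)
    moreover have "K n \<inter> f -` C = ?L"
      by auto
    ultimately have "compact ?L"
      using compactK closedin_compact by metis
    then have "closed (p ` ?L)"
      using cont_p by (intro compact_imp_closed compact_continuous_image) (auto intro: continuous_on_subset)
    then have "p -` (p ` ?L) \<inter> S \<in> sets ?F"
      by (intro in_vimage_algebra borel_closed)
    moreover have "p -` (p ` ?L) \<inter> S = ?L"
      using p(2) K(2)[of n] by (auto simp: inj_on_def subset_iff)
    ultimately show ?thesis
      by simp
  qed
  \<comment> \<open>The value 0 is arbitrary: it is taken within \<open>S\<close> only on the null
    remainder, which belongs to \<open>?F\<close> by \<open>KU\<close>.\<close>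
  define g where "g = (\<lambda>x. if x \<in> (\<Union>n. K n) then f x else 0)"
  have KU: "(\<Union>n. K n) \<in> sets ?F"
    using piece[of UNIV] by auto
  show thesis
  proof
    show "g \<in> borel_measurable ?F"
    proof (rule borel_measurableI)
      fix V :: "real set" assume "open V"
      \<comment> \<open>\<open>piece\<close> speaks of closed sets, hence the passage to
        \<open>- V\<close>. The remainder contributes exactly when the default value 0 lies in
        \<open>- V\<close>.\<close>
      have "g -` V \<inter> space ?F = space ?F - (g -` (- V) \<inter> space ?F)"
        by auto
      also have "g -` (- V) \<inter> space ?F =
          (\<Union>n. {x \<in> K n. f x \<in> - V}) \<union> (if 0 \<in> - V then space ?F - (\<Union>n. K n) else {})"
        using K(2) by (auto simp: g_def subset_iff split: if_splits)
      finally show "g -` V \<inter> space ?F \<in> sets ?F"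
        using piece[OF closed_Compl[OF \<open>open V\<close>]] KU
        by (auto simp del: Un_iff space_vimage_algebra intro!: sets.Diff sets.Un sets.countable_UN)
    qed
    have "S - (\<Union>n. K n) \<in> null_sets (lebesgue_on S)"
      using null S(1) by (subst null_sets_restrict_space) auto
    then show "AE x in lebesgue_on S. f x = g x"
      by (rule AE_I') (auto simp: g_def)
  qed
qed

section \<open>Orthogonal projection and the subspace of \<open>sigma_gen I p\<close>\<close>

lemma L2_diff:
  assumes "f \<in> L2 M" "g \<in> L2 M"
  shows "(\<lambda>x. f x - g x) \<in> L2 M"
proof -
  have [measurable]: "f \<in> borel_measurable M" "g \<in> borel_measurable M"
    and int: "integrable M (\<lambda>x. 2 * (f x)\<^sup>2 + 2 * (g x)\<^sup>2)"
    using assms by (auto simp: L2_def)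
  \<comment> \<open>The right side minus the left side is the square of
    \<open>f x + g x\<close>.\<close>
  have "(f x - g x)\<^sup>2 \<le> 2 * (f x)\<^sup>2 + 2 * (g x)\<^sup>2" for x
    using zero_le_power2[of "f x + g x"] by (simp add: power2_eq_square algebra_simps)
  then have "integrable M (\<lambda>x. (f x - g x)\<^sup>2)"
    by (intro Bochner_Integration.integrable_bound[OF int]) auto
  then show ?thesis
    by (simp add: L2_def)
qed

text \<open>Since \<open>f\<close> itself meets the defining condition, the choice operator returns
  some \<open>?g\<close> that meets it too. Testing orthogonality against \<open>f - ?g\<close>,
  which is again in \<open>L2 M\<close>, shows that this difference has norm zero.\<close>

lemma orth_proj_L2:
  assumes f: "f \<in> L2 M"
  shows "AE x in M. orth_proj M (L2 M) f x = f x"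
proof -
  let ?g = "orth_proj M (L2 M) f"
  have "f \<in> L2 M \<and> (\<forall>h\<in>L2 M. L2_inner M (\<lambda>x. f x - f x) h = 0)"
    using f by (simp add: L2_inner_def)
  then have g: "?g \<in> L2 M \<and> (\<forall>h\<in>L2 M. L2_inner M (\<lambda>x. f x - ?g x) h = 0)"
    unfolding orth_proj_def
    by (rule someI[where P = "\<lambda>g. g \<in> L2 M \<and> (\<forall>h\<in>L2 M. L2_inner M (\<lambda>x. f x - g x) h = 0)"])
  then have d: "(\<lambda>x. f x - ?g x) \<in> L2 M"
    using L2_diff f by blast
  then have "(\<integral>x. (f x - ?g x)\<^sup>2 \<partial>M) = 0"
    using g by (auto simp: L2_inner_def power2_eq_square)
  moreover have "integrable M (\<lambda>x. (f x - ?g x)\<^sup>2)"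
    using d by (simp add: L2_def)
  ultimately have "AE x in M. (f x - ?g x)\<^sup>2 = 0"
    by (subst (asm) integral_nonneg_eq_0_iff_AE) auto
  then show ?thesis
    by eventually_elim simp
qed

text \<open>Turns \<open>P_op I p\<close> into the projection onto the whole space. Square
  integrability passes from \<open>f\<close> to its \<open>?F\<close>-measurable version by equality
  almost everywhere, and then to the restricted measure.\<close>

lemma L2_sub_sigma_gen_inj:
  assumes I: "I \<in> sets lebesgue" "bounded I"
    and p: "p \<in> borel_measurable (lebesgue_on I)" "inj_on p I"
  shows "L2_sub (lebesgue_on I) (sigma_gen I p) = L2 (lebesgue_on I)"
proof -
  let ?M = "lebesgue_on I" and ?F = "sigma_gen I p"
  have sub: "subalgebra ?M ?F"
    using p(1) sets_image_in_sets[of ?M I p borel]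
    by (auto simp: subalgebra_def sigma_gen_def)
  have "\<exists>g \<in> L2 (restr_to_subalg ?M ?F). AE x in ?M. f x = g x" if f: "f \<in> L2 ?M" for f
  proof -
    have fm: "f \<in> borel_measurable ?M" and fi: "integrable ?M (\<lambda>x. (f x)\<^sup>2)"
      using f by (auto simp: L2_def)
    obtain g where g: "g \<in> borel_measurable ?F" "AE x in ?M. f x = g x"
      using borel_measurable_AE_vimage_algebra_inj[OF I p fm] by (auto simp: sigma_gen_def)
    have gM: "g \<in> borel_measurable ?M"
      using measurable_from_subalg[OF sub g(1)] .
    have "integrable ?M (\<lambda>x. (g x)\<^sup>2)"
      using g(2) by (intro integrable_cong_AE_imp[OF fi]) (use gM in auto)
    then have "integrable (restr_to_subalg ?M ?F) (\<lambda>x. (g x)\<^sup>2)"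
      using g(1) by (intro integrable_in_subalg[OF sub]) auto
    then have "g \<in> L2 (restr_to_subalg ?M ?F)"
      using measurable_in_subalg[OF sub g(1)] by (simp add: L2_def)
    then show ?thesis
      using g(2) by blast
  qed
  then show ?thesis
    by (auto simp: L2_sub_def)
qed

section \<open>Powers of weights bounded away from zero\<close>

lemma Linfty_plus_AE_lower_bound:
  assumes "\<gamma> \<in> Linfty_plus M"
  obtains c where "c > 0" "AE x in M. c \<le> \<gamma> x"
proof -
  have "0 < - esssup M (\<lambda>x. - ereal (\<gamma> x))"
    using assms by (simp add: Linfty_plus_def essinf_def)
  \<comment> \<open>A real number strictly in between exists even if the essential infimum is
    infinite, as on a null space.\<close>
  then obtain c where c: "0 < ereal c" "ereal c < - esssup M (\<lambda>x. - ereal (\<gamma> x))"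
    using ereal_dense2 by blast
  have "AE x in M. - ereal (\<gamma> x) \<le> esssup M (\<lambda>x. - ereal (\<gamma> x))"
    by (rule esssup_AE)
  then have "AE x in M. c \<le> \<gamma> x"
  proof eventually_elim
    case (elim x)
    then have "- esssup M (\<lambda>x. - ereal (\<gamma> x)) \<le> ereal (\<gamma> x)"
      by (simp add: ereal_uminus_le_reorder)
    then show ?case
      using c(2) by (metis ereal_less_eq(3) less_le_trans less_imp_le)
  qed
  then show thesis
    using c(1) that by simp
qed

text \<open>The function is essentially bounded on a finite measure space: the base
  \<open>1 / \<gamma> x\<close> is at most \<open>1 / c\<close>, and the exponent
  \<open>1 / (p x - 1)\<close> is at most \<open>1 / (q - 1)\<close>.\<close>

lemma powr_L2:
  assumes "finite_measure M"
    and \<gamma>: "\<gamma> \<in> Linfty_plus M" and p: "p \<in> borel_measurable M"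
    and q: "1 < q" "AE x in M. q < p x"
  shows "(\<lambda>x. \<gamma> x powr (- 1 / (p x - 1))) \<in> L2 M"
proof -
  interpret finite_measure M by fact
  obtain c where c: "c > 0" "AE x in M. c \<le> \<gamma> x"
    using Linfty_plus_AE_lower_bound[OF \<gamma>] .
  have [measurable]: "\<gamma> \<in> borel_measurable M" "p \<in> borel_measurable M"
    using \<gamma> p by (auto simp: Linfty_plus_def Linfty_def)
  \<comment> \<open>The maximum with 1 makes \<open>D powr t\<close> increasing in \<open>t\<close>,
    so the exponent can be enlarged to \<open>1 / (q - 1)\<close>.\<close>
  define D where "D = max 1 (1 / c)"
  define B where "B = D powr (1 / (q - 1))"
  have "AE x in M. norm ((\<gamma> x powr (- 1 / (p x - 1)))\<^sup>2) \<le> B\<^sup>2"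
    using c(2) q(2)
  proof eventually_elim
    case (elim x)
    have "\<gamma> x powr (- 1 / (p x - 1)) = (1 / \<gamma> x) powr (1 / (p x - 1))"
      using c(1) elim(1) by (simp add: powr_minus powr_divide inverse_eq_divide)
    also have "\<dots> \<le> D powr (1 / (p x - 1))"
    proof (rule powr_mono2)
      have "1 / \<gamma> x \<le> 1 / c"
        using c(1) elim(1) by (simp add: frac_le)
      then show "1 / \<gamma> x \<le> D"
        by (simp add: D_def)
    qed (use c(1) elim q(1) in auto)
    also have "\<dots> \<le> B"
      unfolding B_def using elim(2) q(1) by (intro powr_mono) (auto simp: D_def frac_le)
    finally show ?case
      by (simp add: power_mono)
  qed
  then have "integrable M (\<lambda>x. (\<gamma> x powr (- 1 / (p x - 1)))\<^sup>2)"
    by (intro integrable_const_bound) auto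
  then show ?thesis
    by (simp add: L2_def)
qed

text \<open>More than injectivity: each weight is a fixed point of \<open>P_tilde I p\<close> up to
  null sets, so it can be read off from its image.\<close>

lemma P_tilde_inj:
  assumes I: "I \<in> sets lebesgue" "bounded I"
    and p: "p \<in> borel_measurable (lebesgue_on I)" "inj_on p I"
    and q: "1 < q" "AE x in lebesgue_on I. q < p x"
    and \<gamma>: "\<gamma> \<in> Linfty_plus (lebesgue_on I)"
  shows "AE x in lebesgue_on I. P_tilde I p \<gamma> x = \<gamma> x"
proof -
  have "finite_measure (lebesgue_on I)"
    using I by (intro finite_measure_lebesgue_on bounded_set_imp_lmeasurable)
  then have P: "AE x in lebesgue_on I. P_op I p (\<lambda>y. \<gamma> y powr (- 1 / (p y - 1))) x = \<gamma> x powr (- 1 / (p x - 1))"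
    unfolding P_op_def L2_sub_sigma_gen_inj[OF I p]
    by (intro orth_proj_L2 powr_L2[OF _ \<gamma> p(1) q])
  obtain c where c: "c > 0" "AE x in lebesgue_on I. c \<le> \<gamma> x"
    using Linfty_plus_AE_lower_bound[OF \<gamma>] .
  show ?thesis
    using P c(2) q(2)
  proof eventually_elim
    case (elim x)
    \<comment> \<open>The bound \<open>1 < q < p x\<close> excludes a zero denominator;
      \<open>c\<close> makes \<open>\<gamma> x\<close> positive, so that its power with exponent 1
      is \<open>\<gamma> x\<close>.\<close>
    have "- 1 / (p x - 1) * - (p x - 1) = 1"
      using elim(3) q(1) by (simp add: field_simps)
    then have "(\<gamma> x powr (- 1 / (p x - 1))) powr (- (p x - 1)) = \<gamma> x"
      unfolding powr_powr using elim(2) c(1) by (metis powr_one less_le_trans less_imp_le)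
    then show ?case
      using elim(1) by (simp only: P_tilde_def)
  qed
qed

theorem corollary2:
  fixes a b p_minus p_plus :: real and I :: "real set"
    and p \<gamma>1 \<gamma>2 :: "real \<Rightarrow> real"
  assumes "a < b" and "I = {a<..<b}"
    and "p \<in> borel_measurable (lebesgue_on I)"
    and "1 < p_minus"
    and "AE x in lebesgue_on I. p_minus < p x \<and> p x < p_plus"
    and "\<gamma>1 \<in> Linfty_plus (lebesgue_on I)"
    and "\<gamma>2 \<in> Linfty_plus (lebesgue_on I)"
    and "inj_on p I"
    and "AE x in lebesgue_on I. P_tilde I p \<gamma>1 x = P_tilde I p \<gamma>2 x"
  shows "AE x in lebesgue_on I. \<gamma>1 x = \<gamma>2 x"
proof -
  have I: "I \<in> sets lebesgue" "bounded I"
    using assms(2) by auto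
  have q: "AE x in lebesgue_on I. p_minus < p x"
    using assms(5) by eventually_elim simp
  note P = P_tilde_inj[OF I assms(3,8,4) q]
  show ?thesis
    using P[OF assms(6)] P[OF assms(7)] assms(9) by eventually_elim simp
qed

end
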